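(* Let $M\in\mathbb C^{n\times n}$ and $\varepsilon>0$. Let $$\Delta_{\rm opt}=\operatorname{diag}(\delta_1 I_{r_1},\ldots,\delta_S I_{r_S},\Delta_1,\ldots,\Delta_F)\in\mathbb B^*,\qquad \|\Delta_{\rm opt}\|_2=1,$$ be a local extremizer of $\Lambda_\varepsilon^{\mathbb B^*}(M)$. Assume that $\varepsilon M\Delta_{\rm opt}$ has a simple largest eigenvalue $\lambda=|\lambda|e^{\mathbf i\theta}$, with right and left eigenvectors $x$ and $y$ scaled such that $s=e^{\mathbf i\theta}y^*x>0$. Let $z=M^*y$ and partition $$x=(x_1^{\rm T},\ldots,x_S^{\rm T},x_{S+1}^{\rm T},\ldots,x_{S+F}^{\rm T})^{\rm T},\qquad z=(z_1^{\rm T},\ldots,z_S^{\rm T},z_{S+1}^{\rm T},\ldots,z_{S+F}^{\rm T})^{\rm T}$$ such that the size of $x_k,z_k$ equals the size of the $k$-th diagonal block of $\Delta_{\rm opt}$. Assume additionally that $$z_k^*x_k\neq 0\quad\text{for all }k=1,\ldots,S,\qquad \|z_{S+h}\|_2\cdot\|x_{S+h}\|_2\neq 0\quad\text{for all }h=1,\ldots,F.$$ Then $|\delta_k|=1$ for all $k=1,\ldots,S$ and $\|\Delta_h\|_2=1$ for all $h=1,\ldots,F$; that is, all blocks of $\Delta_{\rm opt}$ have unit $2$-norm.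
   Context: Fix nonnegative integers $S,F$ and positive integers $r_1,\ldots,r_S,m_1,\ldots,m_F$ with $\sum_i r_i+\sum_j m_j=n$. The purely complex perturbation set is $$\mathbb B^*=\{\operatorname{diag}(\delta_1 I_{r_1},\ldots,\delta_S I_{r_S},\Delta_1,\ldots,\Delta_F):\ \delta_i\in\mathbb C,\ \Delta_j\in\mathbb C^{m_j\times m_j}\}.$$ $\|\cdot\|_2$ is the spectral norm (Euclidean norm for vectors), $\Lambda(\cdot)$ the spectrum, $\rho(\cdot)$ the spectral radius, $\mathbf i$ the imaginary unit. The structured spectral value set is $$\Lambda_\varepsilon^{\mathbb B^*}(M)=\{\lambda\in\Lambda(\varepsilon M\Delta):\ \Delta\in\mathbb B^*,\ \|\Delta\|_2\le 1\}.$$ A "largest eigenvalue" of a matrix is an eigenvalue whose modulus equals the spectral radius. A matrix $\Delta\in\mathbb B^*$ is called a local extremizer of $\Lambda_\varepsilon^{\mathbb B^*}(M)$ if $\|\Delta\|_2\le1$ and $\varepsilon M\Delta$ has a largest eigenvalue that locally maximizes the modulus of $\Lambda_\varepsilon^{\mathbb B^*}(M)$ (i.e. it is a local maximizer of $w\mapsto|w|$ on this set). A left eigenvector $y\ne0$ of $C$ for $\lambda$ satisfies $y^*(C-\lambda I)=0$. *)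

theory Defs
  imports "HOL-Analysis.L2_Norm" "Jordan_Normal_Form.Spectral_Radius"
begin

text \<open>
  Throughout, \<open>y\<^sup>* x\<close> is written \<open>x \<bullet>c y\<close>: the library's \<open>\<bullet>c\<close> conjugates its
  second argument.
\<close>

definition vec_norm2 :: "complex vec \<Rightarrow> real" where
  "vec_norm2 v = L2_set (\<lambda>i. cmod (v $ i)) {..<dim_vec v}"

definition spectral_norm :: "complex mat \<Rightarrow> real" where
  "spectral_norm A =
     Sup {vec_norm2 (A *\<^sub>v v) | v. v \<in> carrier_vec (dim_col A) \<and> vec_norm2 v \<le> 1}"

text \<open>\<open>y \<noteq> 0\<close> and \<open>y\<^sup>* (C - \<lambda> I) = 0\<close>, with \<open>y\<^sup>*\<close> taken as a one-row matrix.\<close>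

definition left_eigenvector :: "complex mat \<Rightarrow> complex vec \<Rightarrow> complex \<Rightarrow> bool" where
  "left_eigenvector C y l \<longleftrightarrow>
     y \<in> carrier_vec (dim_row C) \<and> y \<noteq> 0\<^sub>v (dim_row C) \<and>
     mat_of_row (conjugate y) * (C - l \<cdot>\<^sub>m 1\<^sub>m (dim_row C)) = 0\<^sub>m 1 (dim_col C)"

definition largest_eigenvalue :: "complex mat \<Rightarrow> complex \<Rightarrow> bool" where
  "largest_eigenvalue A l \<longleftrightarrow> eigenvalue A l \<and> cmod l = spectral_radius A"

text \<open>Simple means of algebraic multiplicity one.\<close>

definition simple_eigenvalue :: "complex mat \<Rightarrow> complex \<Rightarrow> bool" where
  "simple_eigenvalue A l \<longleftrightarrow> eigenvalue A l \<and> order l (char_poly A) = 1"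

text \<open>
  The block structure is given by the lists \<open>r = [r\<^sub>1, \<dots>, r\<^sub>S]\<close> (repeated scalar blocks) and
  \<open>m = [m\<^sub>1, \<dots>, m\<^sub>F]\<close> (full blocks), so \<open>S = length r\<close> and \<open>F = length m\<close>, either possibly zero.
  All indices are shifted to start from zero.
\<close>

definition pert_coords :: "nat list \<Rightarrow> nat list \<Rightarrow> complex list \<Rightarrow> complex mat list \<Rightarrow> bool" where
  "pert_coords r m \<delta> \<Delta> \<longleftrightarrow>
     length \<delta> = length r \<and> length \<Delta> = length m \<and>
     (\<forall>h<length m. \<Delta> ! h \<in> carrier_mat (m ! h) (m ! h))"

definition pert_mat :: "nat list \<Rightarrow> complex list \<Rightarrow> complex mat list \<Rightarrow> complex mat" where
  "pert_mat r \<delta> \<Delta> = diag_block_mat (map2 (\<lambda>d k. d \<cdot>\<^sub>m 1\<^sub>m k) \<delta> r @ \<Delta>)"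

definition pert_set :: "nat list \<Rightarrow> nat list \<Rightarrow> complex mat set" where
  "pert_set r m = {pert_mat r \<delta> \<Delta> | \<delta> \<Delta>. pert_coords r m \<delta> \<Delta>}"

definition structured_spectral_value_set ::
    "nat list \<Rightarrow> nat list \<Rightarrow> real \<Rightarrow> complex mat \<Rightarrow> complex set" where
  "structured_spectral_value_set r m \<epsilon> M =
     (\<Union>D \<in> {D \<in> pert_set r m. spectral_norm D \<le> 1}.
        spectrum (complex_of_real \<epsilon> \<cdot>\<^sub>m (M * D)))"

definition local_max_modulus :: "complex set \<Rightarrow> complex \<Rightarrow> bool" where
  "local_max_modulus A l \<longleftrightarrow>
     l \<in> A \<and> (\<exists>e>0. \<forall>w\<in>A. dist w l < e \<longrightarrow> cmod w \<le> cmod l)"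

definition local_extremizer ::
    "nat list \<Rightarrow> nat list \<Rightarrow> real \<Rightarrow> complex mat \<Rightarrow> complex mat \<Rightarrow> bool" where
  "local_extremizer r m \<epsilon> M D \<longleftrightarrow>
     D \<in> pert_set r m \<and> spectral_norm D \<le> 1 \<and>
     (\<exists>l. largest_eigenvalue (complex_of_real \<epsilon> \<cdot>\<^sub>m (M * D)) l \<and>
          local_max_modulus (structured_spectral_value_set r m \<epsilon> M) l)"

text \<open>The \<open>k\<close>-th subvector (from zero) of \<open>v\<close> in its partition into consecutive pieces of sizes \<open>ns\<close>.\<close>

definition vec_block :: "nat list \<Rightarrow> nat \<Rightarrow> complex vec \<Rightarrow> complex vec" where
  "vec_block ns k v = vec (ns ! k) (\<lambda>i. v $ (sum_list (take k ns) + i))"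

end

theory Submission
  imports Defs
begin

text \<open>
  Multiplying a structured perturbation by a scalar \<open>c\<close> with \<open>\<bar>c\<bar> \<le> 1\<close> again gives an admissible
  one and multiplies the eigenvalues of \<open>\<epsilon> M D\<close> by \<open>c\<close>. The structured spectral value set is
  therefore a union of discs about the origin, so a point at which the modulus is locally maximal has
  globally maximal modulus (\<open>local_max_modulus_imp_global\<close>). In particular the given simple
  eigenvalue \<open>lam\<close> of largest modulus has globally maximal modulus, even if the eigenvalue that
  witnesses the extremality of \<open>Dopt\<close> is a different one of the same modulus.

  Suppose that a block of \<open>Dopt\<close> has norm less than 1. Since the norm of a block diagonal matrix
  is governed by its blocks, \<open>Dopt + \<mu> E\<close> stays admissible for all small complex \<open>\<mu>\<close>,
  whenever \<open>E\<close> is a structured matrix that vanishes outside this block. To first order, the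
  eigenvalue \<open>lam\<close> moves by \<open>\<mu> \<epsilon> (z\<^sup>* E x) / (y\<^sup>* x)\<close>. If \<open>z\<^sup>* E x \<noteq> 0\<close>, the
  moving eigenvalue covers a whole neighbourhood of \<open>lam\<close>
  (\<open>simple_eigenvalue_open_mapping\<close>), including points of modulus larger than that of \<open>lam\<close>, a
  contradiction. Hence \<open>z\<^sup>* E x = 0\<close> for all such \<open>E\<close>
  (\<open>extremizer_block_first_order_condition\<close>). For a repeated scalar block take the identity, which
  gives \<open>z\<^sub>k\<^sup>* x\<^sub>k = 0\<close>; for a full block take \<open>z\<^sub>k x\<^sub>k\<^sup>*\<close>, which gives
  \<open>\<parallel>z\<^sub>k\<parallel>\<^sup>2 \<parallel>x\<^sub>k\<parallel>\<^sup>2 = 0\<close>. Both are excluded by hypothesis.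

  The covering statement is proved through the resolvent, with no analytic dependence of eigenvalues
  on parameters. Write the characteristic polynomial of \<open>A\<close> as \<open>(X - lam) q\<close> with
  \<open>q(lam) \<noteq> 0\<close>. The matrix \<open>H(w) = adj(w - A) / q(w)\<close> equals \<open>(w - lam) (w - A)\<^sup>-\<^sup>1\<close> off the
  spectrum and is continuous at \<open>lam\<close>, where it is the spectral projection
  \<open>x y\<^sup>* / (y\<^sup>* x)\<close>. So \<open>H(lam) B\<close> has the eigenvalue \<open>k = y\<^sup>* B x / (y\<^sup>* x) \<noteq> 0\<close>, and for
  \<open>w\<close> near \<open>lam\<close> the matrix \<open>H(w) B\<close> has an eigenvalue \<open>a\<close> near \<open>k\<close>. Applying \<open>w - A\<close> to
  \<open>H(w) B v = a v\<close> shows that \<open>w\<close> is an eigenvalue of \<open>A + \<mu> B\<close> with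
  \<open>\<mu> = (w - lam) / a\<close>, which is small.
\<close>

section \<open>Entrywise limits of matrices\<close>

lemma tendsto_det:
  fixes L :: "'a::real_normed_field mat"
  assumes A: "\<And>w. A w \<in> carrier_mat n n" and L: "L \<in> carrier_mat n n"
    and lim: "\<And>i j. i < n \<Longrightarrow> j < n \<Longrightarrow> ((\<lambda>w. A w $$ (i,j)) \<longlongrightarrow> L $$ (i,j)) F"
  shows "((\<lambda>w. det (A w)) \<longlongrightarrow> det L) F"
proof -
  have "((\<lambda>w. \<Sum>p \<in> {p. p permutes {0..<n}}. signof p * (\<Prod>i = 0..<n. A w $$ (i, p i)))
      \<longlongrightarrow> (\<Sum>p \<in> {p. p permutes {0..<n}}. signof p * (\<Prod>i = 0..<n. L $$ (i, p i)))) F"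
    by (intro tendsto_sum tendsto_mult tendsto_const tendsto_prod lim)
      (auto dest: permutes_in_image)
  thus ?thesis by (simp add: det_def'[OF A] det_def'[OF L])
qed

lemma tendsto_adj_mat:
  fixes L :: "'a::real_normed_field mat"
  assumes A: "\<And>w. A w \<in> carrier_mat n n" and L: "L \<in> carrier_mat n n"
    and lim: "\<And>i j. i < n \<Longrightarrow> j < n \<Longrightarrow> ((\<lambda>w. A w $$ (i,j)) \<longlongrightarrow> L $$ (i,j)) F"
    and ij: "i < n" "j < n"
  shows "((\<lambda>w. adj_mat (A w) $$ (i,j)) \<longlongrightarrow> adj_mat L $$ (i,j)) F"
proof -
  have dims: "dim_row (A w) = n" "dim_col (A w) = n" for w using A[of w] by auto
  have "((\<lambda>w. det (mat_delete (A w) j i)) \<longlongrightarrow> det (mat_delete L j i)) F"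
    by (rule tendsto_det[OF mat_delete_carrier[OF A] mat_delete_carrier[OF L]])
      (use L lim in \<open>auto simp: mat_delete_def dims\<close>)
  thus ?thesis using ij L dims
    by (auto simp: adj_mat_def cofactor_def intro!: tendsto_intros)
qed

lemma tendsto_mult_mat_right:
  fixes L :: "'a::real_normed_field mat"
  assumes A: "\<And>w. A w \<in> carrier_mat n k" and L: "L \<in> carrier_mat n k" and B: "B \<in> carrier_mat k l"
    and lim: "\<And>i j. i < n \<Longrightarrow> j < k \<Longrightarrow> ((\<lambda>w. A w $$ (i,j)) \<longlongrightarrow> L $$ (i,j)) F"
    and ij: "i < n" "j < l"
  shows "((\<lambda>w. (A w * B) $$ (i,j)) \<longlongrightarrow> (L * B) $$ (i,j)) F"
proof -
  have dims: "dim_row (A w) = n" "dim_col (A w) = k" for w using A[of w] by auto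
  show ?thesis using ij L B
    by (auto simp: scalar_prod_def dims intro!: tendsto_intros lim)
qed

lemma tendsto_mult_mat_vec_scalar_prod:
  fixes L :: "'a::real_normed_field mat"
  assumes A: "\<And>w. A w \<in> carrier_mat n n" and L: "L \<in> carrier_mat n n"
    and lim: "\<And>i j. i < n \<Longrightarrow> j < n \<Longrightarrow> ((\<lambda>w. A w $$ (i,j)) \<longlongrightarrow> L $$ (i,j)) F"
    and v: "v \<in> carrier_vec n" and u: "u \<in> carrier_vec n"
  shows "((\<lambda>w. (A w *\<^sub>v v) \<bullet> u) \<longlongrightarrow> (L *\<^sub>v v) \<bullet> u) F"
proof -
  have dims: "dim_row (A w) = n" "dim_col (A w) = n" for w using A[of w] by auto
  show ?thesis using L v u
    by (auto simp: scalar_prod_def dims intro!: tendsto_intros lim)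
qed

section \<open>Kernel of a singular matrix with non-zero adjugate\<close>

text \<open>
  Replacing row \<open>i\<close> of \<open>N\<close> by the \<open>j\<close>-th unit row keeps \<open>v\<close> in the kernel, because
  \<open>v\<^sub>j = 0\<close>, and turns the determinant into the cofactor.
\<close>

lemma cofactor_eq_0_if_kernel_vec:
  fixes N :: "'a::field mat"
  assumes N: "N \<in> carrier_mat n n" and v: "v \<in> carrier_vec n" "v \<noteq> 0\<^sub>v n" "N *\<^sub>v v = 0\<^sub>v n"
    and ij: "i < n" "j < n" and vj: "v $ j = 0"
  shows "cofactor N i j = 0"
proof -
  define N' where "N' = mat n n (\<lambda>(a,b). if a = i then (if b = j then 1 else 0) else N $$ (a,b))"
  have N': "N' \<in> carrier_mat n n" by (simp add: N'_def)
  have "N' *\<^sub>v v = 0\<^sub>v n"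
  proof (rule eq_vecI)
    fix a assume "a < dim_vec (0\<^sub>v n :: 'a vec)"
    hence a: "a < n" by simp
    have "(N' *\<^sub>v v) $ a = (\<Sum>b = 0..<n. N' $$ (a,b) * v $ b)"
      using a N' v by (simp add: scalar_prod_def)
    also have "\<dots> = 0"
    proof (cases "a = i")
      case True
      thus ?thesis using a vj by (intro sum.neutral) (auto simp: N'_def)
    next
      case False
      have "(\<Sum>b = 0..<n. N' $$ (a,b) * v $ b) = (N *\<^sub>v v) $ a"
        using False a N v(1) by (simp add: scalar_prod_def N'_def)
      thus ?thesis using a v(3) by simp
    qed
    finally show "(N' *\<^sub>v v) $ a = 0\<^sub>v n $ a" using a by simp
  qed (simp add: N'_def)
  hence "det N' = 0" using det_0_iff_vec_prod_zero[OF N'] v by blast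
  moreover have "det N' = (\<Sum>b<n. N' $$ (i,b) * cofactor N' i b)"
    by (rule laplace_expansion_row[OF N' ij(1)])
  moreover have "\<dots> = (\<Sum>b<n. if b = j then cofactor N' i b else 0)"
    using ij by (intro sum.cong) (auto simp: N'_def)
  ultimately have "cofactor N' i j = 0" using ij by simp
  moreover have "mat_delete N' i j = mat_delete N i j"
    by (rule eq_matI) (use N ij in \<open>auto simp: mat_delete_def N'_def\<close>)
  ultimately show ?thesis by (simp add: cofactor_def)
qed

text \<open>
  Two independent kernel vectors can be combined to cancel any prescribed coordinate, so a kernel of
  dimension at least two forces every cofactor to vanish.
\<close>

lemma kernel_one_dim_if_adj_mat_nonzero:
  fixes N :: "'a::field mat"
  assumes N: "N \<in> carrier_mat n n" and adj: "adj_mat N \<noteq> 0\<^sub>m n n"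
    and x: "x \<in> carrier_vec n" "x \<noteq> 0\<^sub>v n" "N *\<^sub>v x = 0\<^sub>v n"
    and u: "u \<in> carrier_vec n" "N *\<^sub>v u = 0\<^sub>v n"
  shows "\<exists>c. u = c \<cdot>\<^sub>v x"
proof (rule ccontr)
  assume indep: "\<nexists>c. u = c \<cdot>\<^sub>v x"
  have ex: "\<exists>v \<in> carrier_vec n. v \<noteq> 0\<^sub>v n \<and> N *\<^sub>v v = 0\<^sub>v n \<and> v $ j = 0" if j: "j < n" for j
  proof (cases "x $ j = 0")
    case True
    thus ?thesis using x by blast
  next
    case False
    define c where "c = u $ j / x $ j"
    define v where "v = u - c \<cdot>\<^sub>v x"
    have v: "v \<in> carrier_vec n" using x u by (simp add: v_def)
    have "u = c \<cdot>\<^sub>v x" if "v = 0\<^sub>v n"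
    proof (rule eq_vecI)
      fix i assume i: "i < dim_vec (c \<cdot>\<^sub>v x)"
      have "v $ i = 0" using that i x by simp
      thus "u $ i = (c \<cdot>\<^sub>v x) $ i" using i x u by (simp add: v_def)
    qed (use u x in auto)
    with indep have "v \<noteq> 0\<^sub>v n" by blast
    moreover have "N *\<^sub>v v = 0\<^sub>v n"
      using N x u by (auto simp: v_def mult_minus_distrib_mat_vec mult_mat_vec)
    moreover have "v $ j = 0" using False j x u by (simp add: v_def c_def)
    ultimately show ?thesis using v by blast
  qed
  have "adj_mat N = 0\<^sub>m n n"
  proof (rule eq_matI)
    fix i j assume "i < dim_row (0\<^sub>m n n :: 'a mat)" "j < dim_col (0\<^sub>m n n :: 'a mat)"
    hence ij: "i < n" "j < n" by auto
    have "cofactor N j i = 0" using ex[OF ij(1)] cofactor_eq_0_if_kernel_vec[OF N _ _ _ ij(2,1)] by blast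
    thus "adj_mat N $$ (i,j) = 0\<^sub>m n n $$ (i,j)" using ij N by (simp add: adj_mat_def)
  qed (use N in \<open>auto simp: adj_mat_def\<close>)
  with adj show False by blast
qed

section \<open>Perturbation of a simple eigenvalue\<close>

text \<open>
  The value at \<open>k\<close> is the product of the \<open>n\<close> differences between \<open>k\<close> and the eigenvalues, so one
  of the factors is small. This replaces the continuity of polynomial roots.
\<close>

lemma eigenvalue_near_if_char_poly_small:
  fixes C :: "complex mat"
  assumes C: "C \<in> carrier_mat n n" and r: "r \<ge> 0"
    and small: "cmod (poly (char_poly C) k) < r ^ n"
  shows "\<exists>a. eigenvalue C a \<and> cmod (k - a) < r"
proof (rule ccontr)
  assume far: "\<not> ?thesis"
  obtain as where as: "char_poly C = (\<Prod>a\<leftarrow>as. [:- a, 1:])" "length as = n"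
    using char_poly_factorized[OF C] by blast
  have "cmod (k - a) \<ge> r" if "a \<in> set as" for a
  proof -
    have "poly (char_poly C) a = 0" using that by (auto simp: as poly_prod_list prod_list_zero_iff)
    thus ?thesis using far eigenvalue_root_char_poly[OF C] by force
  qed
  hence "r ^ length as \<le> cmod (\<Prod>a\<leftarrow>as. k - a)"
    using r by (induction as) (auto simp: norm_mult intro!: mult_mono)
  also have "(\<Prod>a\<leftarrow>as. k - a) = poly (char_poly C) k"
    by (simp add: as poly_prod_list o_def)
  finally show False using small as by simp
qed

lemma char_matrix_mult_vec:
  assumes "A \<in> carrier_mat n n" "v \<in> carrier_vec n"
  shows "- char_matrix A w *\<^sub>v v = w \<cdot>\<^sub>v v - A *\<^sub>v v"
  using assms
  by (intro eq_vecI) (auto simp: char_matrix_def add_scalar_prod_distrib[of _ n] uminus_scalar_prod)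


text \<open>
  The eigenvalue \<open>lam\<close> of \<open>A + \<mu> B\<close> has derivative \<open>y\<^sup>* B x / (y\<^sup>* x) \<noteq> 0\<close> at
  \<open>\<mu> = 0\<close>, so its values fill a neighbourhood of \<open>lam\<close>. Instead of following the eigenvalue as a
  function of \<open>\<mu>\<close>, the proof prescribes the value \<open>w\<close> and finds \<open>\<mu>\<close> from an eigenvalue of
  \<open>H(w) B\<close>, where \<open>H(w)\<close> is the resolvent of \<open>A\<close> rescaled by \<open>w - lam\<close> to be regular at
  \<open>lam\<close>.
\<close>

lemma simple_eigenvalue_open_mapping:
  fixes A B :: "complex mat"
  assumes A: "A \<in> carrier_mat n n" and B: "B \<in> carrier_mat n n"
    and simple: "order lam (char_poly A) = 1"
    and x: "x \<in> carrier_vec n" "A *\<^sub>v x = lam \<cdot>\<^sub>v x"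
    and y: "y \<in> carrier_vec n" "\<And>v. v \<in> carrier_vec n \<Longrightarrow> (A *\<^sub>v v) \<bullet>c y = lam * (v \<bullet>c y)"
    and xy: "x \<bullet>c y \<noteq> 0" and Bxy: "(B *\<^sub>v x) \<bullet>c y \<noteq> 0"
    and \<eta>: "\<eta> > 0"
  shows "eventually (\<lambda>w. \<exists>\<mu>. cmod \<mu> \<le> \<eta> \<and> eigenvalue (A + \<mu> \<cdot>\<^sub>m B) w) (at lam)"
proof -
  define N where "N w = - char_matrix A w" for w
  have N: "N w \<in> carrier_mat n n" for w using A by (simp add: N_def)
  have Nv: "N w *\<^sub>v v = w \<cdot>\<^sub>v v - A *\<^sub>v v" if "v \<in> carrier_vec n" for w v
    using char_matrix_mult_vec[OF A that] by (simp add: N_def)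
  have y': "conjugate y \<in> carrier_vec n" using y by simp
  have chi0: "char_poly A \<noteq> 0" using degree_monic_char_poly[OF A] by auto
  obtain q where q: "char_poly A = [:- lam, 1:] * q" and ql: "poly q lam \<noteq> 0"
    using order_decomp[OF chi0, of lam] simple by (auto simp: poly_eq_0_iff_dvd)
  have detN: "det (N w) = (w - lam) * poly q w" for w
    using char_poly_matrix[OF A, of w] by (simp add: N_def q algebra_simps)
  define H where "H w = inverse (poly q w) \<cdot>\<^sub>m adj_mat (N w)" for w
  have adjN: "adj_mat (N w) \<in> carrier_mat n n" for w by (rule adj_mat(1)[OF N])
  have H: "H w \<in> carrier_mat n n" for w using adjN[of w] by (simp add: H_def)
  have NH: "N w * H w = (w - lam) \<cdot>\<^sub>m 1\<^sub>m n" if "poly q w \<noteq> 0" for w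
  proof -
    have "N w * H w = inverse (poly q w) \<cdot>\<^sub>m (N w * adj_mat (N w))"
      unfolding H_def by (rule mult_smult_distrib[OF N adjN])
    also have "\<dots> = (inverse (poly q w) * ((w - lam) * poly q w)) \<cdot>\<^sub>m 1\<^sub>m n"
      using adj_mat(2)[OF N, of w] by (auto simp: detN)
    also have "inverse (poly q w) * ((w - lam) * poly q w) = w - lam" using that by simp
    finally show ?thesis .
  qed
  have NHv: "N w *\<^sub>v (H w *\<^sub>v v) = (w - lam) \<cdot>\<^sub>v v" if "poly q w \<noteq> 0" "v \<in> carrier_vec n" for w v
  proof -
    have "N w *\<^sub>v (H w *\<^sub>v v) = (N w * H w) *\<^sub>v v"
      using assoc_mult_mat_vec[OF N H] that by simp
    thus ?thesis using that by (auto simp: NH intro!: eq_vecI)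
  qed
  have Nlim: "((\<lambda>w. N w $$ (i,j)) \<longlongrightarrow> N lam $$ (i,j)) (at lam)" if "i < n" "j < n" for i j
    using that A by (auto simp: N_def char_matrix_def intro!: tendsto_intros)
  have Hlim: "((\<lambda>w. H w $$ (i,j)) \<longlongrightarrow> H lam $$ (i,j)) (at lam)" if "i < n" "j < n" for i j
  proof -
    have "((\<lambda>w. inverse (poly q w) * adj_mat (N w) $$ (i,j))
        \<longlongrightarrow> inverse (poly q lam) * adj_mat (N lam) $$ (i,j)) (at lam)"
      using tendsto_adj_mat[OF N N Nlim that] ql by (intro tendsto_intros) auto
    moreover have "H w $$ (i,j) = inverse (poly q w) * adj_mat (N w) $$ (i,j)" for w
      using that adjN[of w] by (simp add: H_def)
    ultimately show ?thesis by simp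
  qed
  have evq: "eventually (\<lambda>w. poly q w \<noteq> 0) (at lam)"
  proof -
    have "(poly q \<longlongrightarrow> poly q lam) (at lam)" by (intro tendsto_intros)
    thus ?thesis using ql by (rule tendsto_imp_eventually_ne)
  qed
  \<comment> \<open>\<open>y\<^sup>* H(w) = y\<^sup>*\<close> holds off the spectrum because \<open>y\<^sup>* (w - A) = (w - lam) y\<^sup>*\<close>, and at \<open>lam\<close> by continuity.\<close>
  have yH: "(H lam *\<^sub>v v) \<bullet>c y = v \<bullet>c y" if v: "v \<in> carrier_vec n" for v
  proof -
    have pw: "(H w *\<^sub>v v) \<bullet>c y = v \<bullet>c y" if qw: "poly q w \<noteq> 0" and w: "w \<noteq> lam" for w
    proof -
      have Hv: "H w *\<^sub>v v \<in> carrier_vec n" by (rule mult_mat_vec_carrier[OF H v])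
      have "(w - lam) * (v \<bullet>c y) = (N w *\<^sub>v (H w *\<^sub>v v)) \<bullet>c y"
        using v y' by (simp add: NHv[OF qw v])
      also have "\<dots> = w * ((H w *\<^sub>v v) \<bullet>c y) - (A *\<^sub>v (H w *\<^sub>v v)) \<bullet>c y"
        using Hv A y' by (simp add: Nv minus_scalar_prod_distrib[of _ n])
      also have "\<dots> = (w - lam) * ((H w *\<^sub>v v) \<bullet>c y)"
        using y(2)[OF Hv] by (simp add: algebra_simps)
      finally show ?thesis using w by simp
    qed
    have "eventually (\<lambda>w. (H w *\<^sub>v v) \<bullet>c y = v \<bullet>c y) (at lam)"
      using evq eventually_neq_at_within[of lam lam UNIV] by eventually_elim (rule pw)
    hence "((\<lambda>w. (H w *\<^sub>v v) \<bullet>c y) \<longlongrightarrow> v \<bullet>c y) (at lam)" by (rule tendsto_eventually)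
    moreover have "((\<lambda>w. (H w *\<^sub>v v) \<bullet>c y) \<longlongrightarrow> (H lam *\<^sub>v v) \<bullet>c y) (at lam)"
      by (rule tendsto_mult_mat_vec_scalar_prod[OF H H Hlim v y'])
    ultimately show ?thesis by (intro tendsto_unique[OF _ _ ]) auto
  qed
  have x0: "x \<noteq> 0\<^sub>v n" using xy y' by auto
  have Nx: "N lam *\<^sub>v x = 0\<^sub>v n" using x by (simp add: Nv)
  define u where "u = H lam *\<^sub>v (B *\<^sub>v x)"
  have Bx: "B *\<^sub>v x \<in> carrier_vec n" using B x by simp
  have u: "u \<in> carrier_vec n" unfolding u_def by (rule mult_mat_vec_carrier[OF H Bx])
  have "(lam - lam) \<cdot>\<^sub>v (B *\<^sub>v x) = 0\<^sub>v n" using B by (intro eq_vecI) auto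
  hence "N lam *\<^sub>v u = 0\<^sub>v n" using NHv[OF ql Bx] by (simp add: u_def)
  moreover have "adj_mat (N lam) \<noteq> 0\<^sub>m n n"
  proof
    assume "adj_mat (N lam) = 0\<^sub>m n n"
    hence "H lam *\<^sub>v x = 0\<^sub>v n" using x by (auto simp: H_def)
    thus False using yH[OF x(1)] xy y' by simp
  qed
  \<comment> \<open>The columns of \<open>H(lam)\<close> lie in the kernel of \<open>lam - A\<close>, which is spanned by \<open>x\<close>.\<close>
  ultimately obtain k where k: "u = k \<cdot>\<^sub>v x"
    using kernel_one_dim_if_adj_mat_nonzero[OF N _ x(1) x0 Nx u] by blast
  have "k * (x \<bullet>c y) = (B *\<^sub>v x) \<bullet>c y" using yH[OF Bx] k x y' by (simp add: u_def[symmetric])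
  hence k0: "k \<noteq> 0" using Bxy by auto
  have HB: "H w * B \<in> carrier_mat n n" for w by (rule mult_carrier_mat[OF H B])
  have "eigenvector (H lam * B) x k"
    using x x0 k assoc_mult_mat_vec[OF H B x(1)] H[of lam] by (simp add: eigenvector_def u_def)
  hence root: "poly (char_poly (H lam * B)) k = 0"
    using eigenvalue_root_char_poly[OF HB] by (auto simp: eigenvalue_def)
  have "((\<lambda>w. poly (char_poly (H w * B)) k) \<longlongrightarrow> poly (char_poly (H lam * B)) k) (at lam)"
    unfolding char_poly_matrix[OF HB]
  proof (rule tendsto_det)
    fix i j assume ij: "i < n" "j < n"
    have "((\<lambda>w. - ((H w * B) $$ (i,j) + (- k \<cdot>\<^sub>m 1\<^sub>m n) $$ (i,j)))
        \<longlongrightarrow> - ((H lam * B) $$ (i,j) + (- k \<cdot>\<^sub>m 1\<^sub>m n) $$ (i,j))) (at lam)"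
      by (intro tendsto_intros tendsto_mult_mat_right[OF H H B Hlim] ij)
    moreover have "(- char_matrix (H w * B) k) $$ (i,j)
        = - ((H w * B) $$ (i,j) + (- k \<cdot>\<^sub>m 1\<^sub>m n) $$ (i,j))" for w
      using ij H[of w] B by (auto simp: char_matrix_def)
    ultimately show "((\<lambda>w. (- char_matrix (H w * B) k) $$ (i,j))
        \<longlongrightarrow> (- char_matrix (H lam * B) k) $$ (i,j)) (at lam)" by simp
  qed (use HB in auto)
  hence "eventually (\<lambda>w. cmod (poly (char_poly (H w * B)) k) < (cmod k / 2) ^ n) (at lam)"
    using k0 unfolding root by (auto dest!: tendstoD[where e = "(cmod k / 2) ^ n"])
  moreover have "eventually (\<lambda>w. cmod (w - lam) < \<eta> * cmod k / 2) (at lam)"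
    using k0 \<eta> by (auto simp: eventually_at dist_norm intro!: exI[of _ "\<eta> * cmod k / 2"])
  ultimately show ?thesis using evq
  proof eventually_elim
    case (elim w)
    obtain a where a: "eigenvalue (H w * B) a" "cmod (k - a) < cmod k / 2"
      using eigenvalue_near_if_char_poly_small[OF HB _ elim(1)] by auto
    have ak: "cmod a > cmod k / 2" using a(2) norm_triangle_ineq2[of k a] by linarith
    hence a0: "a \<noteq> 0" using k0 by auto
    obtain v where v: "v \<in> carrier_vec n" "v \<noteq> 0\<^sub>v n" "(H w * B) *\<^sub>v v = a \<cdot>\<^sub>v v"
      using a(1) H[of w] by (auto simp: eigenvalue_def eigenvector_def)
    have Bv: "B *\<^sub>v v \<in> carrier_vec n" "A *\<^sub>v v \<in> carrier_vec n" using A B v by auto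
    \<comment> \<open>Apply \<open>w - A\<close> to \<open>H(w) B v = a v\<close>.\<close>
    have "(w - lam) \<cdot>\<^sub>v (B *\<^sub>v v) = N w *\<^sub>v (a \<cdot>\<^sub>v v)"
      using NHv[OF elim(3) Bv(1)] assoc_mult_mat_vec[OF H B v(1), of w] v(3) by simp
    also have "\<dots> = a \<cdot>\<^sub>v (w \<cdot>\<^sub>v v - A *\<^sub>v v)"
      using mult_mat_vec[OF N v(1)] Nv[OF v(1)] by simp
    finally have eq: "(w - lam) \<cdot>\<^sub>v (B *\<^sub>v v) = a \<cdot>\<^sub>v (w \<cdot>\<^sub>v v - A *\<^sub>v v)" .
    define \<mu> where "\<mu> = (w - lam) / a"
    have "(A + \<mu> \<cdot>\<^sub>m B) *\<^sub>v v = w \<cdot>\<^sub>v v"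
    proof (rule eq_vecI)
      fix i assume "i < dim_vec (w \<cdot>\<^sub>v v)"
      hence i: "i < n" using v by simp
      have "(w - lam) * (B *\<^sub>v v) $ i = a * (w * v $ i - (A *\<^sub>v v) $ i)"
        using arg_cong[OF eq, of "\<lambda>v. v $ i"] i v Bv A B by simp
      hence "(A *\<^sub>v v) $ i + \<mu> * (B *\<^sub>v v) $ i = w * v $ i"
        using a0 by (simp add: \<mu>_def field_simps)
      thus "((A + \<mu> \<cdot>\<^sub>m B) *\<^sub>v v) $ i = (w \<cdot>\<^sub>v v) $ i"
        using i A B v by (simp add: add_scalar_prod_distrib[of _ n])
    qed (use A v B in auto)
    hence "eigenvalue (A + \<mu> \<cdot>\<^sub>m B) w"
      using v A B by (auto simp: eigenvalue_def eigenvector_def)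
    moreover have "cmod \<mu> \<le> \<eta>"
    proof -
      have "cmod (w - lam) \<le> \<eta> * cmod a"
        using elim(2) mult_strict_left_mono[OF ak \<eta>] by linarith
      thus ?thesis using a0 by (simp add: \<mu>_def norm_divide pos_divide_le_eq)
    qed
    ultimately show ?case by blast
  qed
qed

section \<open>Spectral norm and contractions\<close>

lemma vec_norm2_square: "(vec_norm2 v)\<^sup>2 = (\<Sum>i<dim_vec v. (cmod (v $ i))\<^sup>2)"
  by (simp add: vec_norm2_def L2_set_def sum_nonneg)

lemma vec_norm2_nonneg [simp]: "0 \<le> vec_norm2 v"
  by (simp add: vec_norm2_def L2_set_nonneg)

lemma mult_mat_zero_vec [simp]: "A *\<^sub>v 0\<^sub>v (dim_col A) = 0\<^sub>v (dim_row A)"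
  by (intro eq_vecI) auto

lemma vec_norm2_zero [simp]: "vec_norm2 (0\<^sub>v n) = 0"
  by (simp add: vec_norm2_def L2_set_def)

lemma vec_norm2_eq_0_iff: "vec_norm2 v = 0 \<longleftrightarrow> v = 0\<^sub>v (dim_vec v)"
  unfolding vec_norm2_def
  by (subst L2_set_eq_0_iff) (auto intro!: eq_vecI, metis index_zero_vec(1))

lemma vec_norm2_smult: "vec_norm2 (c \<cdot>\<^sub>v v) = cmod c * vec_norm2 v"
  by (simp add: vec_norm2_def L2_set_right_distrib norm_mult cong: L2_set_cong_simp)

lemma vec_norm2_triangle:
  assumes "dim_vec v = dim_vec w"
  shows "vec_norm2 (v + w) \<le> vec_norm2 v + vec_norm2 w"
proof -
  have "vec_norm2 (v + w) \<le> L2_set (\<lambda>i. cmod (v $ i) + cmod (w $ i)) {..<dim_vec w}"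
    by (auto simp: vec_norm2_def intro!: L2_set_mono norm_triangle_ineq)
  also have "\<dots> \<le> vec_norm2 v + vec_norm2 w"
    using assms by (simp add: vec_norm2_def L2_set_triangle_ineq)
  finally show ?thesis .
qed

lemma vec_norm2_append: "(vec_norm2 (v @\<^sub>v w))\<^sup>2 = (vec_norm2 v)\<^sup>2 + (vec_norm2 w)\<^sup>2"
proof -
  let ?f = "\<lambda>i. (cmod ((v @\<^sub>v w) $ i))\<^sup>2"
  have "(vec_norm2 (v @\<^sub>v w))\<^sup>2 = sum ?f {..<dim_vec v} + sum ?f {dim_vec v..<dim_vec v + dim_vec w}"
    unfolding vec_norm2_square lessThan_atLeast0
    by (subst sum.atLeastLessThan_concat) (simp_all del: index_append_vec(1))
  also have "sum ?f {dim_vec v..<dim_vec v + dim_vec w} = (\<Sum>i<dim_vec w. (cmod (w $ i))\<^sup>2)"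
    using sum.shift_bounds_nat_ivl[of ?f 0 "dim_vec v" "dim_vec w"]
    by (simp add: lessThan_atLeast0 add.commute)
  finally show ?thesis by (simp add: vec_norm2_square)
qed

lemma mat_mult_vec_bounded:
  "\<exists>C. \<forall>v \<in> carrier_vec (dim_col A). vec_norm2 (A *\<^sub>v v) \<le> C * vec_norm2 v"
proof (intro exI ballI)
  fix v :: "complex vec" assume v: "v \<in> carrier_vec (dim_col A)"
  have "cmod ((A *\<^sub>v v) $ i) \<le> (\<Sum>j<dim_col A. cmod (A $$ (i,j))) * vec_norm2 v"
    if "i < dim_row A" for i
  proof -
    have "cmod ((A *\<^sub>v v) $ i) \<le> (\<Sum>j<dim_col A. cmod (A $$ (i,j) * v $ j))"
      using that v by (auto simp: scalar_prod_def lessThan_atLeast0 intro!: norm_sum)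
    also have "\<dots> \<le> (\<Sum>j<dim_col A. cmod (A $$ (i,j)) * vec_norm2 v)"
      using v by (auto simp: norm_mult vec_norm2_def intro!: sum_mono mult_left_mono member_le_L2_set)
    finally show ?thesis by (simp add: sum_distrib_right)
  qed
  hence "(\<Sum>i<dim_row A. cmod ((A *\<^sub>v v) $ i))
      \<le> (\<Sum>i<dim_row A. \<Sum>j<dim_col A. cmod (A $$ (i,j))) * vec_norm2 v"
    by (auto simp: sum_distrib_right intro!: sum_mono)
  moreover have "vec_norm2 (A *\<^sub>v v) \<le> (\<Sum>i<dim_row A. cmod ((A *\<^sub>v v) $ i))"
    unfolding vec_norm2_def by (simp del: index_mult_mat_vec add: L2_set_le_sum)
  ultimately show "vec_norm2 (A *\<^sub>v v)
      \<le> (\<Sum>i<dim_row A. \<Sum>j<dim_col A. cmod (A $$ (i,j))) * vec_norm2 v" by linarith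
qed

lemma bdd_above_unit_ball_image:
  "bdd_above {vec_norm2 (A *\<^sub>v v) | v. v \<in> carrier_vec (dim_col A) \<and> vec_norm2 v \<le> 1}"
proof -
  obtain C where C: "\<forall>v \<in> carrier_vec (dim_col A). vec_norm2 (A *\<^sub>v v) \<le> C * vec_norm2 v"
    using mat_mult_vec_bounded by blast
  show ?thesis
  proof (rule bdd_aboveI[of _ "max C 0"])
    fix t assume "t \<in> {vec_norm2 (A *\<^sub>v v) | v. v \<in> carrier_vec (dim_col A) \<and> vec_norm2 v \<le> 1}"
    then obtain v where v: "t = vec_norm2 (A *\<^sub>v v)" "v \<in> carrier_vec (dim_col A)" "vec_norm2 v \<le> 1"
      by blast
    have "t \<le> C * vec_norm2 v" using C v by simp
    also have "\<dots> \<le> max C 0 * 1" using v by (intro mult_mono) auto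
    finally show "t \<le> max C 0" by simp
  qed
qed

lemma spectral_norm_nonneg [simp]: "0 \<le> spectral_norm A"
  unfolding spectral_norm_def
  by (rule cSup_upper2[OF _ _ bdd_above_unit_ball_image, of 0])
    (auto intro!: exI[of _ "0\<^sub>v (dim_col A)"])

lemma vec_norm2_mult_le:
  assumes v: "v \<in> carrier_vec (dim_col A)"
  shows "vec_norm2 (A *\<^sub>v v) \<le> spectral_norm A * vec_norm2 v"
proof (cases "vec_norm2 v = 0")
  case True
  hence "v = 0\<^sub>v (dim_col A)" using v by (simp add: vec_norm2_eq_0_iff)
  thus ?thesis by auto
next
  case False
  define t where "t = vec_norm2 v"
  have t: "t > 0" using False vec_norm2_nonneg[of v] by (simp add: t_def order_less_le)
  define c :: complex where "c = of_real (inverse t)"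
  have c: "cmod c = inverse t" using t by (simp add: c_def norm_inverse)
  have "vec_norm2 (A *\<^sub>v (c \<cdot>\<^sub>v v)) \<le> spectral_norm A"
    unfolding spectral_norm_def
    by (rule cSup_upper[OF _ bdd_above_unit_ball_image])
      (use t v c in \<open>auto simp: vec_norm2_smult t_def intro!: exI[of _ "c \<cdot>\<^sub>v v"]\<close>)
  also have "A *\<^sub>v (c \<cdot>\<^sub>v v) = c \<cdot>\<^sub>v (A *\<^sub>v v)"
    by (rule mult_mat_vec[OF _ v]) auto
  finally have "inverse t * vec_norm2 (A *\<^sub>v v) \<le> spectral_norm A" by (simp add: vec_norm2_smult c)
  thus ?thesis using t by (simp add: t_def[symmetric] field_simps)
qed

lemma spectral_norm_le:
  assumes "\<And>v. v \<in> carrier_vec (dim_col A) \<Longrightarrow> vec_norm2 (A *\<^sub>v v) \<le> c * vec_norm2 v" and c: "c \<ge> 0"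
  shows "spectral_norm A \<le> c"
  unfolding spectral_norm_def
proof (rule cSup_least)
  show "{vec_norm2 (A *\<^sub>v v) | v. v \<in> carrier_vec (dim_col A) \<and> vec_norm2 v \<le> 1} \<noteq> {}"
    by (auto intro!: exI[of _ "0\<^sub>v (dim_col A)"])
  fix t assume "t \<in> {vec_norm2 (A *\<^sub>v v) | v. v \<in> carrier_vec (dim_col A) \<and> vec_norm2 v \<le> 1}"
  then obtain v where v: "t = vec_norm2 (A *\<^sub>v v)" "v \<in> carrier_vec (dim_col A)" "vec_norm2 v \<le> 1"
    by blast
  have "t \<le> c * vec_norm2 v" using assms v by simp
  also have "\<dots> \<le> c * 1" using v c by (intro mult_left_mono) auto
  finally show "t \<le> c" by simp
qed

text \<open>
  The condition \<open>\<parallel>A\<parallel> \<le> 1\<close> without the supremum, so that it can be tested vector by vector.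
\<close>

definition contraction :: "complex mat \<Rightarrow> bool" where
  "contraction A \<longleftrightarrow> (\<forall>v \<in> carrier_vec (dim_col A). vec_norm2 (A *\<^sub>v v) \<le> vec_norm2 v)"

lemma spectral_norm_le_1_iff: "spectral_norm A \<le> 1 \<longleftrightarrow> contraction A"
proof
  assume le: "spectral_norm A \<le> 1"
  show "contraction A" unfolding contraction_def
  proof
    fix v :: "complex vec" assume v: "v \<in> carrier_vec (dim_col A)"
    have "vec_norm2 (A *\<^sub>v v) \<le> spectral_norm A * vec_norm2 v" by (rule vec_norm2_mult_le[OF v])
    also have "\<dots> \<le> 1 * vec_norm2 v" using le by (intro mult_right_mono) auto
    finally show "vec_norm2 (A *\<^sub>v v) \<le> vec_norm2 v" by simp
  qed
next
  assume "contraction A"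
  thus "spectral_norm A \<le> 1" by (intro spectral_norm_le) (auto simp: contraction_def)
qed

lemma contraction_smult:
  assumes "contraction A" and c: "cmod c \<le> 1"
  shows "contraction (c \<cdot>\<^sub>m A)"
  unfolding contraction_def
proof
  fix v :: "complex vec" assume v: "v \<in> carrier_vec (dim_col (c \<cdot>\<^sub>m A))"
  have "(c \<cdot>\<^sub>m A) *\<^sub>v v = c \<cdot>\<^sub>v (A *\<^sub>v v)" using v by (intro eq_vecI) auto
  hence "vec_norm2 ((c \<cdot>\<^sub>m A) *\<^sub>v v) \<le> 1 * vec_norm2 (A *\<^sub>v v)"
    using c by (simp add: vec_norm2_smult mult_left_le_one_le)
  also have "\<dots> \<le> vec_norm2 v" using assms(1) v by (simp add: contraction_def)
  finally show "vec_norm2 ((c \<cdot>\<^sub>m A) *\<^sub>v v) \<le> vec_norm2 v" .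
qed

text \<open>
  The triangle inequality leaves the slack \<open>1 - \<parallel>A\<parallel>\<close> for \<open>\<mu> E\<close>.
\<close>

lemma strict_contraction_stable:
  assumes A: "A \<in> carrier_mat n k" and E: "E \<in> carrier_mat n k" and lt: "spectral_norm A < 1"
  shows "\<exists>\<eta>>0. \<forall>\<mu>. cmod \<mu> \<le> \<eta> \<longrightarrow> contraction (A + \<mu> \<cdot>\<^sub>m E)"
proof (intro exI conjI allI impI)
  define \<eta> where "\<eta> = (1 - spectral_norm A) / (spectral_norm E + 1)"
  have e: "spectral_norm E + 1 > 0" using spectral_norm_nonneg[of E] by linarith
  show "\<eta> > 0" using lt e by (simp add: \<eta>_def)
  fix \<mu> assume \<mu>: "cmod \<mu> \<le> \<eta>"
  have "cmod \<mu> * spectral_norm E \<le> \<eta> * (spectral_norm E + 1)"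
    using \<mu> \<open>\<eta> > 0\<close> by (intro mult_mono) auto
  also have "\<dots> = 1 - spectral_norm A" using e by (simp add: \<eta>_def)
  finally have sum_le: "spectral_norm A + cmod \<mu> * spectral_norm E \<le> 1" by simp
  show "contraction (A + \<mu> \<cdot>\<^sub>m E)" unfolding contraction_def
  proof
    fix v :: "complex vec" assume "v \<in> carrier_vec (dim_col (A + \<mu> \<cdot>\<^sub>m E))"
    hence v: "v \<in> carrier_vec k" using E by simp
    have "(A + \<mu> \<cdot>\<^sub>m E) *\<^sub>v v = A *\<^sub>v v + \<mu> \<cdot>\<^sub>v (E *\<^sub>v v)"
      using A E v by (intro eq_vecI) (auto simp: add_scalar_prod_distrib[of _ k])
    hence "vec_norm2 ((A + \<mu> \<cdot>\<^sub>m E) *\<^sub>v v) \<le> vec_norm2 (A *\<^sub>v v) + cmod \<mu> * vec_norm2 (E *\<^sub>v v)"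
      using vec_norm2_triangle[of "A *\<^sub>v v" "\<mu> \<cdot>\<^sub>v (E *\<^sub>v v)"] A E by (simp add: vec_norm2_smult)
    also have "\<dots> \<le> spectral_norm A * vec_norm2 v + cmod \<mu> * (spectral_norm E * vec_norm2 v)"
      using A E v by (intro add_mono mult_left_mono vec_norm2_mult_le) auto
    also have "\<dots> = (spectral_norm A + cmod \<mu> * spectral_norm E) * vec_norm2 v"
      by (simp add: algebra_simps)
    also have "\<dots> \<le> 1 * vec_norm2 v" using sum_le by (intro mult_right_mono) auto
    finally show "vec_norm2 ((A + \<mu> \<cdot>\<^sub>m E) *\<^sub>v v) \<le> vec_norm2 v" by simp
  qed
qed

lemma smult_one_mult_vec:
  fixes d :: complex
  shows "v \<in> carrier_vec k \<Longrightarrow> (d \<cdot>\<^sub>m 1\<^sub>m k) *\<^sub>v v = d \<cdot>\<^sub>v v"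
  by (intro eq_vecI) auto

lemma spectral_norm_smult_one:
  assumes "k > 0"
  shows "spectral_norm (d \<cdot>\<^sub>m 1\<^sub>m k) = cmod d"
proof (rule antisym)
  show "spectral_norm (d \<cdot>\<^sub>m 1\<^sub>m k) \<le> cmod d"
    by (intro spectral_norm_le) (auto simp: smult_one_mult_vec vec_norm2_smult)
  \<comment> \<open>Any nonzero vector attains the norm; this is where \<open>k > 0\<close> enters.\<close>
  define v :: "complex vec" where "v = unit_vec k 0"
  have v: "v \<in> carrier_vec k" by (simp add: v_def)
  have "vec_norm2 v \<noteq> 0"
    using assms by (auto simp: vec_norm2_eq_0_iff v_def dest!: arg_cong[where f = "\<lambda>v. v $ 0"])
  hence "vec_norm2 v > 0" using vec_norm2_nonneg[of v] by linarith
  moreover have "cmod d * vec_norm2 v \<le> spectral_norm (d \<cdot>\<^sub>m 1\<^sub>m k) * vec_norm2 v"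
    using vec_norm2_mult_le[of v "d \<cdot>\<^sub>m 1\<^sub>m k"] v by (simp add: smult_one_mult_vec vec_norm2_smult)
  ultimately show "cmod d \<le> spectral_norm (d \<cdot>\<^sub>m 1\<^sub>m k)" by simp
qed

section \<open>Block diagonal matrices\<close>

lemma contraction_four_block_diag_iff:
  assumes A: "A \<in> carrier_mat a1 a2" and B: "B \<in> carrier_mat b1 b2"
  shows "contraction (four_block_mat A (0\<^sub>m a1 b2) (0\<^sub>m b1 a2) B) \<longleftrightarrow> contraction A \<and> contraction B"
    (is "contraction ?F \<longleftrightarrow> _")
proof -
  have F: "?F *\<^sub>v (v @\<^sub>v w) = A *\<^sub>v v @\<^sub>v B *\<^sub>v w" if "v \<in> carrier_vec a2" "w \<in> carrier_vec b2" for v w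
    using four_block_mat_mult_vec[OF A _ _ B that, of "0\<^sub>m a1 b2" "0\<^sub>m b1 a2"] A B that by auto
  have sq: "vec_norm2 (?F *\<^sub>v (v @\<^sub>v w)) \<le> vec_norm2 (v @\<^sub>v w) \<longleftrightarrow>
      (vec_norm2 (A *\<^sub>v v))\<^sup>2 + (vec_norm2 (B *\<^sub>v w))\<^sup>2 \<le> (vec_norm2 v)\<^sup>2 + (vec_norm2 w)\<^sup>2"
    if "v \<in> carrier_vec a2" "w \<in> carrier_vec b2" for v w
    using that by (simp flip: vec_norm2_append add: F)
  have dims: "dim_col ?F = a2 + b2" "dim_col A = a2" "dim_col B = b2" using A B by auto
  show ?thesis
  proof safe
    assume c: "contraction ?F"
    have *: "(vec_norm2 (A *\<^sub>v v))\<^sup>2 + (vec_norm2 (B *\<^sub>v w))\<^sup>2 \<le> (vec_norm2 v)\<^sup>2 + (vec_norm2 w)\<^sup>2"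
      if "v \<in> carrier_vec a2" "w \<in> carrier_vec b2" for v w
      using c that unfolding sq[OF that, symmetric] by (auto simp: contraction_def dims)
    have zA: "A *\<^sub>v 0\<^sub>v a2 = 0\<^sub>v a1" and zB: "B *\<^sub>v 0\<^sub>v b2 = 0\<^sub>v b1" using A B by auto
    show "contraction A" using *[of _ "0\<^sub>v b2"] by (simp add: contraction_def dims zB)
    show "contraction B" using *[of "0\<^sub>v a2"] by (simp add: contraction_def dims zA)
  next
    assume c: "contraction A" "contraction B"
    show "contraction ?F" unfolding contraction_def dims
    proof
      fix u :: "complex vec" assume u: "u \<in> carrier_vec (a2 + b2)"
      have "vec_norm2 (?F *\<^sub>v (v @\<^sub>v w)) \<le> vec_norm2 (v @\<^sub>v w)"
        if "v \<in> carrier_vec a2" "w \<in> carrier_vec b2" for v w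
        using c that unfolding sq[OF that] by (auto simp: contraction_def dims intro!: add_mono)
      from this[of "vec_first u a2" "vec_last u b2"]
      show "vec_norm2 (?F *\<^sub>v u) \<le> vec_norm2 u" using u by simp
    qed
  qed
qed

text \<open>
  A direct sum acts on orthogonal subspaces, so it does not increase norms exactly if no summand
  does.
\<close>

lemma contraction_diag_block_mat_iff:
  "contraction (diag_block_mat Ds) \<longleftrightarrow> (\<forall>D \<in> set Ds. contraction D)"
proof (induction Ds)
  case Nil
  show ?case by (auto simp: contraction_def vec_norm2_def L2_set_def)
next
  case (Cons D Ds)
  show ?case using contraction_four_block_diag_iff[of D _ _ "diag_block_mat Ds", OF carrier_matI carrier_matI]
    by (simp add: Let_def Cons.IH)
qed

lemma diag_block_mat_carrier:
  assumes "length Ds = length ns" "\<And>i. i < length ns \<Longrightarrow> Ds ! i \<in> carrier_mat (ns ! i) (ns ! i)"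
  shows "diag_block_mat Ds \<in> carrier_mat (sum_list ns) (sum_list ns)"
proof -
  have "map dim_row Ds = ns" "map dim_col Ds = ns"
    using assms(1) carrier_matD[OF assms(2)] by (auto intro!: nth_equalityI)
  thus ?thesis using dim_diag_block_mat[of Ds] by (intro carrier_matI) auto
qed

lemma diag_block_mat_add_smult:
  fixes Ds Es :: "'a::comm_ring_1 mat list"
  assumes "length Ds = length ns" "length Es = length ns"
    and "\<And>i. i < length ns \<Longrightarrow> Ds ! i \<in> carrier_mat (ns ! i) (ns ! i)"
    and "\<And>i. i < length ns \<Longrightarrow> Es ! i \<in> carrier_mat (ns ! i) (ns ! i)"
  shows "diag_block_mat (map2 (\<lambda>D E. D + \<mu> \<cdot>\<^sub>m E) Ds Es) = diag_block_mat Ds + \<mu> \<cdot>\<^sub>m diag_block_mat Es"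
  using assms
proof (induction ns arbitrary: Ds Es)
  case (Cons k ns)
  obtain D Ds' E Es' where L: "Ds = D # Ds'" "Es = E # Es'"
    using Cons.prems(1,2) by (auto simp: length_Suc_conv)
  have D: "D \<in> carrier_mat k k" and E: "E \<in> carrier_mat k k"
    using Cons.prems(3)[of 0] Cons.prems(4)[of 0] by (auto simp: L)
  have tl: "Ds' ! i \<in> carrier_mat (ns ! i) (ns ! i)" "Es' ! i \<in> carrier_mat (ns ! i) (ns ! i)"
    if "i < length ns" for i
    using that Cons.prems(3)[of "Suc i"] Cons.prems(4)[of "Suc i"] by (auto simp: L)
  have len: "length Ds' = length ns" "length Es' = length ns" using Cons.prems by (auto simp: L)
  define X where "X = diag_block_mat Ds'"
  define Y where "Y = diag_block_mat Es'"
  have X: "X \<in> carrier_mat (sum_list ns) (sum_list ns)"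
    and Y: "Y \<in> carrier_mat (sum_list ns) (sum_list ns)"
    using diag_block_mat_carrier[of _ ns] len tl by (auto simp: X_def Y_def)
  have IH: "diag_block_mat (map2 (\<lambda>D E. D + \<mu> \<cdot>\<^sub>m E) Ds' Es') = X + \<mu> \<cdot>\<^sub>m Y"
    unfolding X_def Y_def by (rule Cons.IH) (use len tl in auto)
  show ?case
    using D E X Y
    by (simp add: L Let_def IH X_def[symmetric] Y_def[symmetric]) (rule eq_matI; auto)
qed auto

lemma vec_block_Cons_0: "vec_block (k # ns) 0 v = vec_first v k"
  by (simp add: vec_block_def vec_first_def)

lemma vec_block_Cons_Suc:
  assumes "v \<in> carrier_vec (k + sum_list ns)" "i < length ns"
  shows "vec_block (k # ns) (Suc i) v = vec_block ns i (vec_last v (sum_list ns))"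
proof (rule eq_vecI)
  fix j assume "j < dim_vec (vec_block ns i (vec_last v (sum_list ns)))"
  hence j: "j < ns ! i" by (simp add: vec_block_def)
  have "sum_list (take i ns) + ns ! i = sum_list (take (Suc i) ns)"
    using assms(2) by (simp add: take_Suc_conv_app_nth)
  also have "\<dots> \<le> sum_list (take (Suc i) ns) + sum_list (drop (Suc i) ns)" by simp
  also have "\<dots> = sum_list ns" by (simp flip: sum_list_append)
  finally have "sum_list (take i ns) + j < sum_list ns" using j by linarith
  thus "vec_block (k # ns) (Suc i) v $ j = vec_block ns i (vec_last v (sum_list ns)) $ j"
    using assms(1) j by (simp add: vec_block_def vec_last_def add.assoc)
qed (simp add: vec_block_def)

lemma vec_block_carrier [simp]: "vec_block ns i v \<in> carrier_vec (ns ! i)"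
  by (simp add: vec_block_def)

text \<open>
  The blocks of a block diagonal matrix pair corresponding subvectors, so a matrix with a single
  nonzero block probes a single pair \<open>x\<^sub>i, z\<^sub>i\<close>.
\<close>

lemma diag_block_mat_cscalar_prod:
  fixes x z :: "complex vec"
  assumes "length Es = length ns"
    and "\<And>i. i < length ns \<Longrightarrow> Es ! i \<in> carrier_mat (ns ! i) (ns ! i)"
    and "x \<in> carrier_vec (sum_list ns)" "z \<in> carrier_vec (sum_list ns)"
  shows "(diag_block_mat Es *\<^sub>v x) \<bullet>c z
    = (\<Sum>i<length ns. (Es ! i *\<^sub>v vec_block ns i x) \<bullet>c vec_block ns i z)"
  using assms
proof (induction ns arbitrary: Es x z)
  case Nil
  thus ?case by (simp add: scalar_prod_def)
next
  case (Cons k ns)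
  obtain E Es' where L: "Es = E # Es'"
    using Cons.prems(1) by (auto simp: length_Suc_conv)
  have E: "E \<in> carrier_mat k k" using Cons.prems(2)[of 0] by (auto simp: L)
  have tl: "Es' ! i \<in> carrier_mat (ns ! i) (ns ! i)" if "i < length ns" for i
    using that Cons.prems(2)[of "Suc i"] by (auto simp: L)
  have len: "length Es' = length ns" using Cons.prems by (auto simp: L)
  define n where "n = sum_list ns"
  define Y where "Y = diag_block_mat Es'"
  have Y: "Y \<in> carrier_mat n n"
    using diag_block_mat_carrier[of _ ns] len tl by (auto simp: Y_def n_def)
  define x1 x2 z1 z2 where "x1 = vec_first x k" "x2 = vec_last x n" "z1 = vec_first z k" "z2 = vec_last z n"
  note d = x1_x2_z1_z2_def
  have c: "x1 \<in> carrier_vec k" "x2 \<in> carrier_vec n" "z1 \<in> carrier_vec k" "z2 \<in> carrier_vec n"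
    by (auto simp: d)
  have xz: "x = x1 @\<^sub>v x2" "z = z1 @\<^sub>v z2" using Cons.prems(3,4) by (auto simp: d n_def)
  have conj: "conjugate (z1 @\<^sub>v z2) = conjugate z1 @\<^sub>v conjugate z2"
    using c by (intro eq_vecI) auto
  have IH: "(Y *\<^sub>v x2) \<bullet>c z2 = (\<Sum>i<length ns. (Es' ! i *\<^sub>v vec_block ns i x2) \<bullet>c vec_block ns i z2)"
    unfolding Y_def by (rule Cons.IH) (use len tl c in \<open>auto simp: n_def\<close>)
  have "diag_block_mat Es *\<^sub>v x = E *\<^sub>v x1 @\<^sub>v Y *\<^sub>v x2"
    using mult_mat_vec_split[OF E Y c(1,2)] E Y by (simp add: L xz Let_def Y_def[symmetric])
  hence "(diag_block_mat Es *\<^sub>v x) \<bullet>c z = (E *\<^sub>v x1) \<bullet>c z1 + (Y *\<^sub>v x2) \<bullet>c z2"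
    using scalar_prod_append[of "E *\<^sub>v x1" k "Y *\<^sub>v x2" n "conjugate z1" "conjugate z2"] E Y c
    by (simp add: xz conj)
  also have "\<dots> = (\<Sum>i<length (k # ns). (Es ! i *\<^sub>v vec_block (k # ns) i x) \<bullet>c vec_block (k # ns) i z)"
    using Cons.prems(3,4)
    by (simp add: sum.lessThan_Suc_shift IH[unfolded d n_def] L vec_block_Cons_0 vec_block_Cons_Suc d n_def
      del: sum.lessThan_Suc)
  finally show ?case .
qed

section \<open>Structured perturbations\<close>

text \<open>
  All diagonal blocks in one list, so that repeated scalar and full blocks can be treated alike.
\<close>

definition pert_blocks :: "nat list \<Rightarrow> complex list \<Rightarrow> complex mat list \<Rightarrow> complex mat list" where
  "pert_blocks r \<delta> \<Delta> = map2 (\<lambda>d k. d \<cdot>\<^sub>m 1\<^sub>m k) \<delta> r @ \<Delta>"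

lemma pert_mat_eq_diag_block_mat: "pert_mat r \<delta> \<Delta> = diag_block_mat (pert_blocks r \<delta> \<Delta>)"
  by (simp add: pert_mat_def pert_blocks_def)

lemma length_pert_blocks: "pert_coords r m \<delta> \<Delta> \<Longrightarrow> length (pert_blocks r \<delta> \<Delta>) = length (r @ m)"
  by (simp add: pert_blocks_def pert_coords_def)

lemma nth_pert_blocks_scalar:
  "pert_coords r m \<delta> \<Delta> \<Longrightarrow> k < length r \<Longrightarrow> pert_blocks r \<delta> \<Delta> ! k = \<delta> ! k \<cdot>\<^sub>m 1\<^sub>m (r ! k)"
  by (simp add: pert_blocks_def pert_coords_def nth_append)

lemma nth_pert_blocks_full:
  "pert_coords r m \<delta> \<Delta> \<Longrightarrow> pert_blocks r \<delta> \<Delta> ! (length r + h) = \<Delta> ! h"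
  by (simp add: pert_blocks_def pert_coords_def nth_append)

lemma pert_index_cases [consumes 1, case_names scalar full]:
  assumes "i < length (r @ m)"
  obtains k where "i = k" "k < length r" | h where "i = length r + h" "h < length m"
  using assms by (metis add_diff_inverse_nat length_append nat_add_left_cancel_less)

lemma nth_pert_blocks_carrier:
  assumes c: "pert_coords r m \<delta> \<Delta>" and i: "i < length (r @ m)"
  shows "pert_blocks r \<delta> \<Delta> ! i \<in> carrier_mat ((r @ m) ! i) ((r @ m) ! i)"
  using i
proof (cases rule: pert_index_cases)
  case (scalar k)
  thus ?thesis using c by (simp add: nth_pert_blocks_scalar nth_append)
next
  case (full h)
  thus ?thesis using c by (simp add: nth_pert_blocks_full nth_append) (simp add: pert_coords_def)
qed

lemma pert_mat_carrier:
  "pert_coords r m \<delta> \<Delta> \<Longrightarrow> pert_mat r \<delta> \<Delta> \<in> carrier_mat (sum_list (r @ m)) (sum_list (r @ m))"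
  unfolding pert_mat_eq_diag_block_mat
  by (rule diag_block_mat_carrier[OF length_pert_blocks nth_pert_blocks_carrier])

lemma pert_mat_add_smult:
  assumes D: "pert_coords r m \<delta> \<Delta>" and E: "pert_coords r m e Es"
  shows "pert_mat r \<delta> \<Delta> + \<mu> \<cdot>\<^sub>m pert_mat r e Es
    = diag_block_mat (map2 (\<lambda>D E. D + \<mu> \<cdot>\<^sub>m E) (pert_blocks r \<delta> \<Delta>) (pert_blocks r e Es))"
  unfolding pert_mat_eq_diag_block_mat
  by (rule diag_block_mat_add_smult[symmetric, where ns = "r @ m"])
    (use D E in \<open>auto simp del: length_append intro: length_pert_blocks nth_pert_blocks_carrier\<close>)

text \<open>
  The structured perturbations form a linear space; with \<open>E = D\<close> this also covers scalar multiples.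
\<close>

lemma pert_set_add_smult:
  assumes "D \<in> pert_set r m" "E \<in> pert_set r m"
  shows "D + \<mu> \<cdot>\<^sub>m E \<in> pert_set r m"
proof -
  obtain \<delta> \<Delta> where D: "D = pert_mat r \<delta> \<Delta>" "pert_coords r m \<delta> \<Delta>"
    using assms(1) by (auto simp: pert_set_def)
  obtain e Es where E: "E = pert_mat r e Es" "pert_coords r m e Es"
    using assms(2) by (auto simp: pert_set_def)
  define \<delta>' where "\<delta>' = map2 (\<lambda>d c. d + \<mu> * c) \<delta> e"
  define \<Delta>' where "\<Delta>' = map2 (\<lambda>D E. D + \<mu> \<cdot>\<^sub>m E) \<Delta> Es"
  have c: "pert_coords r m \<delta>' \<Delta>'"
    using D(2) E(2) by (auto simp: pert_coords_def \<delta>'_def \<Delta>'_def)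
  have "map2 (\<lambda>D E. D + \<mu> \<cdot>\<^sub>m E) (pert_blocks r \<delta> \<Delta>) (pert_blocks r e Es) = pert_blocks r \<delta>' \<Delta>'"
  proof (rule nth_equalityI)
    fix i assume "i < length (map2 (\<lambda>D E. D + \<mu> \<cdot>\<^sub>m E) (pert_blocks r \<delta> \<Delta>) (pert_blocks r e Es))"
    hence i: "i < length (r @ m)" using length_pert_blocks[OF D(2)] by simp
    hence l: "i < length (pert_blocks r \<delta> \<Delta>)" "i < length (pert_blocks r e Es)"
      using length_pert_blocks[OF D(2)] length_pert_blocks[OF E(2)] by auto
    from i show "map2 (\<lambda>D E. D + \<mu> \<cdot>\<^sub>m E) (pert_blocks r \<delta> \<Delta>) (pert_blocks r e Es) ! i
        = pert_blocks r \<delta>' \<Delta>' ! i"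
    proof (cases rule: pert_index_cases)
      case (scalar k)
      have "k < length \<delta>" "k < length e" using scalar D(2) E(2) by (auto simp: pert_coords_def)
      thus ?thesis
        using scalar l nth_pert_blocks_scalar[OF D(2)] nth_pert_blocks_scalar[OF E(2)]
          nth_pert_blocks_scalar[OF c]
        by (auto simp: \<delta>'_def algebra_simps intro!: eq_matI)
    next
      case (full h)
      have "h < length \<Delta>" "h < length Es" using full D(2) E(2) by (auto simp: pert_coords_def)
      thus ?thesis
        using full l nth_pert_blocks_full[OF D(2)] nth_pert_blocks_full[OF E(2)]
          nth_pert_blocks_full[OF c]
        by (auto simp: \<Delta>'_def)
    qed
  qed (use length_pert_blocks[OF D(2)] length_pert_blocks[OF E(2)] length_pert_blocks[OF c] in simp)
  hence "D + \<mu> \<cdot>\<^sub>m E = pert_mat r \<delta>' \<Delta>'"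
    using pert_mat_add_smult[OF D(2) E(2)] D(1) E(1) by (simp add: pert_mat_eq_diag_block_mat)
  thus ?thesis using c by (auto simp: pert_set_def)
qed

lemma pert_set_carrier: "D \<in> pert_set r m \<Longrightarrow> D \<in> carrier_mat (sum_list (r @ m)) (sum_list (r @ m))"
  using pert_mat_carrier by (auto simp: pert_set_def)

lemma pert_set_smult:
  assumes "D \<in> pert_set r m"
  shows "c \<cdot>\<^sub>m D \<in> pert_set r m"
proof -
  have "c \<cdot>\<^sub>m D = D + (c - 1) \<cdot>\<^sub>m D"
    by (rule eq_matI) (auto simp: algebra_simps)
  thus ?thesis using pert_set_add_smult[OF assms assms] by simp
qed

section \<open>The structured spectral value set is a disc\<close>

lemma in_structured_spectral_value_set_iff:
  "w \<in> structured_spectral_value_set r m \<epsilon> M \<longleftrightarrow>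
    (\<exists>D \<in> pert_set r m. contraction D \<and> eigenvalue (complex_of_real \<epsilon> \<cdot>\<^sub>m (M * D)) w)"
  by (auto simp: structured_spectral_value_set_def spectrum_def spectral_norm_le_1_iff)

lemma eigenvalue_smult:
  assumes A: "A \<in> carrier_mat n n" and ev: "eigenvalue A w"
  shows "eigenvalue (c \<cdot>\<^sub>m A) (c * w)"
proof -
  obtain v where v: "v \<in> carrier_vec (n)" "v \<noteq> 0\<^sub>v (n)" "A *\<^sub>v v = w \<cdot>\<^sub>v v"
    using A ev by (auto simp: eigenvalue_def eigenvector_def)
  have "(c \<cdot>\<^sub>m A) *\<^sub>v v = (c * w) \<cdot>\<^sub>v v"
  proof (rule eq_vecI)
    fix i assume "i < dim_vec ((c * w) \<cdot>\<^sub>v v)"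
    hence i: "i < n" using v by simp
    have "row A i \<bullet> v = w * v $ i" using arg_cong[OF v(3), of "\<lambda>u. u $ i"] i v(1) A by simp
    thus "((c \<cdot>\<^sub>m A) *\<^sub>v v) $ i = ((c * w) \<cdot>\<^sub>v v) $ i"
      using i v(1) A by simp
  qed (use v A in simp)
  thus ?thesis using v A by (auto simp: eigenvalue_def eigenvector_def)
qed

text \<open>
  Rescale the perturbation that produces \<open>w\<close> by \<open>w' / w\<close>. For \<open>w = 0\<close> the quotient is 0 by
  convention, which is right since then \<open>w' = 0\<close>.
\<close>

lemma structured_spectral_value_set_disc:
  assumes M: "M \<in> carrier_mat n n" and n: "n = sum_list (r @ m)"
    and w: "w \<in> structured_spectral_value_set r m \<epsilon> M" and le: "cmod w' \<le> cmod w"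
  shows "w' \<in> structured_spectral_value_set r m \<epsilon> M"
proof -
  obtain D where D: "D \<in> pert_set r m" "contraction D" "eigenvalue (complex_of_real \<epsilon> \<cdot>\<^sub>m (M * D)) w"
    using w by (auto simp: in_structured_spectral_value_set_iff)
  define c where "c = w' / w"
  have c: "cmod c \<le> 1" "c * w = w'"
    using le by (auto simp: c_def norm_divide divide_le_eq_1)
  have Dc: "D \<in> carrier_mat n n" using pert_set_carrier[OF D(1)] n by simp
  have "complex_of_real \<epsilon> \<cdot>\<^sub>m (M * (c \<cdot>\<^sub>m D)) = c \<cdot>\<^sub>m (complex_of_real \<epsilon> \<cdot>\<^sub>m (M * D))"
    unfolding mult_smult_distrib[OF M Dc] by (rule eq_matI) auto
  hence "eigenvalue (complex_of_real \<epsilon> \<cdot>\<^sub>m (M * (c \<cdot>\<^sub>m D))) w'"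
    using eigenvalue_smult[OF _ D(3), of n c] c M Dc by simp
  thus ?thesis
    using pert_set_smult[OF D(1)] contraction_smult[OF D(2) c(1)]
    by (auto simp: in_structured_spectral_value_set_iff)
qed

lemma ex_radial_point:
  fixes l :: complex
  assumes "t \<ge> 0"
  shows "\<exists>w. dist w l = t \<and> cmod w = cmod l + t"
proof -
  define u where "u = (if l = 0 then 1 else sgn l)"
  have u: "cmod u = 1" "l = of_real (cmod l) * u"
    by (simp add: u_def norm_sgn) (simp add: u_def sgn_eq)
  define w where "w = l + of_real t * u"
  have "w = of_real (cmod l + t) * u" by (subst u(2)) (simp add: w_def u_def algebra_simps sgn_eq)
  hence "cmod w = cmod l + t" using u(1) assms by (simp add: norm_mult del: of_real_add)
  moreover have "dist w l = t" using u(1) assms by (simp add: w_def dist_norm norm_mult)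
  ultimately show ?thesis by blast
qed

text \<open>
  A point of larger modulus would bring with it the whole disc up to its modulus, which contains
  points just outside \<open>l\<close> on the ray through \<open>l\<close>.
\<close>

lemma local_max_modulus_imp_global:
  assumes M: "M \<in> carrier_mat n n" and n: "n = sum_list (r @ m)"
    and loc: "local_max_modulus (structured_spectral_value_set r m \<epsilon> M) l"
    and w: "w \<in> structured_spectral_value_set r m \<epsilon> M"
  shows "cmod w \<le> cmod l"
proof (rule ccontr)
  assume gt: "\<not> ?thesis"
  obtain e where e: "e > 0"
      "\<And>w. w \<in> structured_spectral_value_set r m \<epsilon> M \<Longrightarrow> dist w l < e \<Longrightarrow> cmod w \<le> cmod l"
    using loc by (auto simp: local_max_modulus_def)
  define t where "t = min (e / 2) (cmod w - cmod l)"
  have t: "t > 0" "t < e" "cmod l + t \<le> cmod w" using gt e by (auto simp: t_def)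
  obtain w' where w': "dist w' l = t" "cmod w' = cmod l + t" using ex_radial_point[of t l] t by auto
  have "w' \<in> structured_spectral_value_set r m \<epsilon> M"
    using structured_spectral_value_set_disc[OF M n w] w' t by simp
  from e(2)[OF this] w' t show False by simp
qed

section \<open>First-order condition at an extremizer\<close>

lemma cscalar_prod_mat_adjoint:
  fixes M :: "complex mat"
  assumes M: "M \<in> carrier_mat n n" and v: "v \<in> carrier_vec n" and y: "y \<in> carrier_vec n"
  shows "(M *\<^sub>v v) \<bullet>c y = v \<bullet>c (mat_adjoint M *\<^sub>v y)"
proof -
  have "(M *\<^sub>v v) \<bullet>c y = (\<Sum>i = 0..<n. \<Sum>j = 0..<n. M $$ (i,j) * v $ j * cnj (y $ i))"
    using assms by (simp add: scalar_prod_def sum_distrib_right)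
  also have "\<dots> = (\<Sum>j = 0..<n. \<Sum>i = 0..<n. M $$ (i,j) * v $ j * cnj (y $ i))"
    by (rule sum.swap)
  also have "\<dots> = v \<bullet>c (mat_adjoint M *\<^sub>v y)"
    using assms
    by (simp add: scalar_prod_def mat_adjoint_def mat_of_rows_index sum_distrib_left mult_ac)
  finally show ?thesis .
qed

lemma left_eigenvector_cscalar_prod:
  assumes A: "A \<in> carrier_mat n n" and y: "left_eigenvector A y lam" and v: "v \<in> carrier_vec n"
  shows "(A *\<^sub>v v) \<bullet>c y = lam * (v \<bullet>c y)"
proof -
  have yc: "y \<in> carrier_vec n" and eq: "mat_of_row (conjugate y) * (A - lam \<cdot>\<^sub>m 1\<^sub>m n) = 0\<^sub>m 1 n"
    using A y by (auto simp: left_eigenvector_def)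
  have y': "conjugate y \<in> carrier_vec n" using yc by simp
  have N: "A - lam \<cdot>\<^sub>m 1\<^sub>m n \<in> carrier_mat n n" using A by (intro carrier_matI) auto
  have Nv: "(A - lam \<cdot>\<^sub>m 1\<^sub>m n) *\<^sub>v v = A *\<^sub>v v - lam \<cdot>\<^sub>v v"
    using A v by (simp add: minus_mult_distrib_mat_vec[of _ n n] smult_one_mult_vec)
  have "mat_of_row (conjugate y) *\<^sub>v (A *\<^sub>v v - lam \<cdot>\<^sub>v v) = 0\<^sub>m 1 n *\<^sub>v v"
    unfolding Nv[symmetric] eq[symmetric]
    by (rule assoc_mult_mat_vec[symmetric, OF _ N v]) (use y' in auto)
  from arg_cong[OF this, of "\<lambda>u. u $ 0"]
  have "conjugate y \<bullet> (A *\<^sub>v v - lam \<cdot>\<^sub>v v) = 0" using v by simp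
  hence "(A *\<^sub>v v - lam \<cdot>\<^sub>v v) \<bullet>c y = 0"
    using comm_scalar_prod[OF y', of "A *\<^sub>v v - lam \<cdot>\<^sub>v v"] A v by simp
  thus ?thesis using A v y' by (simp add: minus_scalar_prod_distrib[of _ n])
qed

text \<open>
  Otherwise some perturbations \<open>D + \<mu> E\<close> would move \<open>lam\<close> radially outwards. The eigenvalue
  that makes \<open>D\<close> a local extremizer may differ from \<open>lam\<close>, but both have the spectral radius as
  modulus, and that modulus is globally maximal.
\<close>

lemma extremizer_first_order_condition:
  assumes M: "M \<in> carrier_mat n n" and n: "n = sum_list (r @ m)" and \<epsilon>: "\<epsilon> > 0"
    and ext: "local_extremizer r m \<epsilon> M D"
    and simple: "simple_eigenvalue (complex_of_real \<epsilon> \<cdot>\<^sub>m (M * D)) lam"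
    and largest: "largest_eigenvalue (complex_of_real \<epsilon> \<cdot>\<^sub>m (M * D)) lam"
    and x: "eigenvector (complex_of_real \<epsilon> \<cdot>\<^sub>m (M * D)) x lam"
    and y: "left_eigenvector (complex_of_real \<epsilon> \<cdot>\<^sub>m (M * D)) y lam"
    and xy: "x \<bullet>c y \<noteq> 0"
    and E: "E \<in> pert_set r m" and \<eta>: "\<eta> > 0"
    and adm: "\<And>\<mu>. cmod \<mu> \<le> \<eta> \<Longrightarrow> contraction (D + \<mu> \<cdot>\<^sub>m E)"
  shows "(E *\<^sub>v x) \<bullet>c (mat_adjoint M *\<^sub>v y) = 0"
proof (rule ccontr)
  assume nz: "(E *\<^sub>v x) \<bullet>c (mat_adjoint M *\<^sub>v y) \<noteq> 0"
  have Dset: "D \<in> pert_set r m" using ext by (simp add: local_extremizer_def)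
  have D: "D \<in> carrier_mat n n" and Ec: "E \<in> carrier_mat n n"
    using pert_set_carrier Dset E n by auto
  define A where "A = complex_of_real \<epsilon> \<cdot>\<^sub>m (M * D)"
  define B where "B = complex_of_real \<epsilon> \<cdot>\<^sub>m (M * E)"
  have A: "A \<in> carrier_mat n n" and B: "B \<in> carrier_mat n n"
    using M D Ec by (auto simp: A_def B_def)
  have AB: "complex_of_real \<epsilon> \<cdot>\<^sub>m (M * (D + \<mu> \<cdot>\<^sub>m E)) = A + \<mu> \<cdot>\<^sub>m B" for \<mu>
  proof -
    have "M * (D + \<mu> \<cdot>\<^sub>m E) = M * D + \<mu> \<cdot>\<^sub>m (M * E)"
      using mult_add_distrib_mat[OF M D, of "\<mu> \<cdot>\<^sub>m E"] mult_smult_distrib[OF M Ec] Ec by simp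
    moreover have "complex_of_real \<epsilon> \<cdot>\<^sub>m (M * D + \<mu> \<cdot>\<^sub>m (M * E)) = A + \<mu> \<cdot>\<^sub>m B"
      unfolding A_def B_def by (rule eq_matI) (use M D Ec in \<open>auto simp: algebra_simps\<close>)
    ultimately show ?thesis by simp
  qed
  have xc: "x \<in> carrier_vec n" "A *\<^sub>v x = lam \<cdot>\<^sub>v x"
    using x A by (auto simp: eigenvector_def A_def[symmetric])
  have yc: "y \<in> carrier_vec n" using y A by (auto simp: left_eigenvector_def A_def[symmetric])
  have "B *\<^sub>v x = complex_of_real \<epsilon> \<cdot>\<^sub>v (M *\<^sub>v (E *\<^sub>v x))"
    using M Ec xc(1) by (auto simp: B_def row_smult intro!: eq_vecI simp flip: assoc_mult_mat_vec)
  moreover have "(M *\<^sub>v (E *\<^sub>v x)) \<bullet>c y = (E *\<^sub>v x) \<bullet>c (mat_adjoint M *\<^sub>v y)"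
    using cscalar_prod_mat_adjoint[OF M _ yc] Ec xc(1) by simp
  ultimately have Bxy: "(B *\<^sub>v x) \<bullet>c y \<noteq> 0" using nz \<epsilon> M yc by simp
  have "eventually (\<lambda>w. \<exists>\<mu>. cmod \<mu> \<le> \<eta> \<and> eigenvalue (A + \<mu> \<cdot>\<^sub>m B) w) (at lam)"
    using simple_eigenvalue_open_mapping[OF A B _ xc yc _ xy Bxy \<eta>]
      left_eigenvector_cscalar_prod[OF A] y simple
    by (simp add: A_def[symmetric] simple_eigenvalue_def)
  then obtain d where d: "d > 0"
    "\<And>w. w \<noteq> lam \<Longrightarrow> dist w lam < d \<Longrightarrow> \<exists>\<mu>. cmod \<mu> \<le> \<eta> \<and> eigenvalue (A + \<mu> \<cdot>\<^sub>m B) w"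
    by (auto simp: eventually_at)
  obtain w where w: "dist w lam = d / 2" "cmod w = cmod lam + d / 2"
    using ex_radial_point[of "d / 2" lam] d(1) by auto
  obtain \<mu> where \<mu>: "cmod \<mu> \<le> \<eta>" "eigenvalue (A + \<mu> \<cdot>\<^sub>m B) w"
    using d(2)[of w] w d(1) by auto
  have "w \<in> structured_spectral_value_set r m \<epsilon> M"
    using \<mu>(2) adm[OF \<mu>(1)] pert_set_add_smult[OF Dset E]
    by (auto simp: in_structured_spectral_value_set_iff AB)
  moreover obtain l where l: "largest_eigenvalue A l"
      "local_max_modulus (structured_spectral_value_set r m \<epsilon> M) l"
    using ext by (auto simp: local_extremizer_def A_def)
  ultimately have "cmod w \<le> cmod l" using local_max_modulus_imp_global[OF M n] by blast
  also have "cmod l = cmod lam" using l(1) largest by (simp add: largest_eigenvalue_def A_def)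
  finally show False using w d(1) by simp
qed

text \<open>
  Perturbing a block of norm less than 1 and leaving the others untouched is admissible for all small
  \<open>\<mu>\<close>, so the first-order condition applies to every direction supported in that block.
\<close>

lemma extremizer_block_first_order_condition:
  assumes M: "M \<in> carrier_mat n n" and n: "n = sum_list (r @ m)" and \<epsilon>: "\<epsilon> > 0"
    and ext: "local_extremizer r m \<epsilon> M (pert_mat r \<delta> \<Delta>)"
    and simple: "simple_eigenvalue (complex_of_real \<epsilon> \<cdot>\<^sub>m (M * pert_mat r \<delta> \<Delta>)) lam"
    and largest: "largest_eigenvalue (complex_of_real \<epsilon> \<cdot>\<^sub>m (M * pert_mat r \<delta> \<Delta>)) lam"
    and x: "eigenvector (complex_of_real \<epsilon> \<cdot>\<^sub>m (M * pert_mat r \<delta> \<Delta>)) x lam"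
    and y: "left_eigenvector (complex_of_real \<epsilon> \<cdot>\<^sub>m (M * pert_mat r \<delta> \<Delta>)) y lam"
    and xy: "x \<bullet>c y \<noteq> 0"
    and D: "pert_coords r m \<delta> \<Delta>" and E: "pert_coords r m e Es"
    and i: "i < length (r @ m)" and lt: "spectral_norm (pert_blocks r \<delta> \<Delta> ! i) < 1"
    and E0: "\<And>j. j < length (r @ m) \<Longrightarrow> j \<noteq> i \<Longrightarrow>
      pert_blocks r e Es ! j = 0\<^sub>m ((r @ m) ! j) ((r @ m) ! j)"
  shows "(pert_blocks r e Es ! i *\<^sub>v vec_block (r @ m) i x)
    \<bullet>c vec_block (r @ m) i (mat_adjoint M *\<^sub>v y) = 0"
proof -
  note len = length_pert_blocks[OF D] length_pert_blocks[OF E]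
  note carr = nth_pert_blocks_carrier[OF D] nth_pert_blocks_carrier[OF E]
  obtain \<eta> where \<eta>: "\<eta> > 0"
    "\<And>\<mu>. cmod \<mu> \<le> \<eta> \<Longrightarrow> contraction (pert_blocks r \<delta> \<Delta> ! i + \<mu> \<cdot>\<^sub>m pert_blocks r e Es ! i)"
    using strict_contraction_stable[OF carr(1)[OF i] carr(2)[OF i] lt] by blast
  have contr: "contraction (pert_mat r \<delta> \<Delta>)"
    using ext by (simp add: local_extremizer_def spectral_norm_le_1_iff)
  have adm: "contraction (pert_mat r \<delta> \<Delta> + \<mu> \<cdot>\<^sub>m pert_mat r e Es)" if \<mu>: "cmod \<mu> \<le> \<eta>" for \<mu>
    unfolding pert_mat_add_smult[OF D E] contraction_diag_block_mat_iff
  proof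
    fix X assume "X \<in> set (map2 (\<lambda>D E. D + \<mu> \<cdot>\<^sub>m E) (pert_blocks r \<delta> \<Delta>) (pert_blocks r e Es))"
    then obtain j where j: "j < length (r @ m)"
      and X: "X = pert_blocks r \<delta> \<Delta> ! j + \<mu> \<cdot>\<^sub>m pert_blocks r e Es ! j"
      using len by (auto simp: in_set_conv_nth)
    show "contraction X"
    proof (cases "j = i")
      case True
      thus ?thesis using \<eta>(2)[OF \<mu>] X by simp
    next
      case False
      have "X = pert_blocks r \<delta> \<Delta> ! j"
        unfolding X E0[OF j False] by (rule eq_matI) (use carr(1)[OF j] in auto)
      moreover have "pert_blocks r \<delta> \<Delta> ! j \<in> set (pert_blocks r \<delta> \<Delta>)" using j len by simp
      ultimately show ?thesis
        using contr by (simp add: pert_mat_eq_diag_block_mat contraction_diag_block_mat_iff)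
    qed
  qed
  have xc: "x \<in> carrier_vec n" and yc: "y \<in> carrier_vec n"
    using x y M by (auto simp: eigenvector_def left_eigenvector_def)
  define z where "z = mat_adjoint M *\<^sub>v y"
  have z: "z \<in> carrier_vec n" using M by (auto simp: z_def mat_adjoint_def intro!: carrier_vecI)
  have "(pert_mat r e Es *\<^sub>v x) \<bullet>c z = 0"
    unfolding z_def using E
    by (intro extremizer_first_order_condition[OF M n \<epsilon> ext simple largest x y xy _ \<eta>(1) adm])
      (auto simp: pert_set_def)
  also have "(pert_mat r e Es *\<^sub>v x) \<bullet>c z
      = (\<Sum>j<length (r @ m). (pert_blocks r e Es ! j *\<^sub>v vec_block (r @ m) j x) \<bullet>c vec_block (r @ m) j z)"
    unfolding pert_mat_eq_diag_block_mat
    by (rule diag_block_mat_cscalar_prod[OF len(2) carr(2)]) (use xc z n in auto)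
  also have "\<dots> = (\<Sum>j<length (r @ m). if j = i then
      (pert_blocks r e Es ! i *\<^sub>v vec_block (r @ m) i x) \<bullet>c vec_block (r @ m) i z else 0)"
  proof (rule sum.cong[OF refl])
    fix j assume "j \<in> {..<length (r @ m)}"
    hence j: "j < length (r @ m)" by simp
    have "(0\<^sub>m k k *\<^sub>v v) \<bullet>c u = 0" if "v \<in> carrier_vec k" "u \<in> carrier_vec k" for k and v u :: "complex vec"
      using that by (simp add: scalar_prod_def)
    thus "(pert_blocks r e Es ! j *\<^sub>v vec_block (r @ m) j x) \<bullet>c vec_block (r @ m) j z
      = (if j = i then (pert_blocks r e Es ! i *\<^sub>v vec_block (r @ m) i x) \<bullet>c vec_block (r @ m) i z else 0)"
      using E0[OF j] by simp
  qed
  finally show ?thesis using i by (simp add: z_def)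
qed

lemma cscalar_prod_self: "v \<bullet>c v = complex_of_real ((vec_norm2 v)\<^sup>2)"
  by (simp add: vec_norm2_square scalar_prod_def lessThan_atLeast0 complex_norm_square
      del: of_real_power)

text \<open>
  The rank-one matrix \<open>u v\<^sup>*\<close> maximizes \<open>u\<^sup>* W v\<close> among matrices of its norm; it is the direction
  in which a full block is perturbed.
\<close>

lemma outer_product_cscalar_prod:
  assumes u: "u \<in> carrier_vec k" and v: "v \<in> carrier_vec k"
  shows "(mat k k (\<lambda>(i,j). u $ i * cnj (v $ j)) *\<^sub>v v) \<bullet>c u
    = complex_of_real ((vec_norm2 u * vec_norm2 v)\<^sup>2)"
proof -
  have "mat k k (\<lambda>(i,j). u $ i * cnj (v $ j)) *\<^sub>v v = (v \<bullet>c v) \<cdot>\<^sub>v u"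
    using u v by (intro eq_vecI) (auto simp: scalar_prod_def sum_distrib_left sum_distrib_right mult_ac)
  hence "(mat k k (\<lambda>(i,j). u $ i * cnj (v $ j)) *\<^sub>v v) \<bullet>c u = (v \<bullet>c v) * (u \<bullet>c u)"
    using u by simp
  thus ?thesis by (simp add: cscalar_prod_self power_mult_distrib)
qed

theorem theorem3p3:
  fixes n :: nat and r m :: "nat list"
    and M :: "complex mat" and \<epsilon> \<theta> s :: real
    and \<delta> :: "complex list" and \<Delta> :: "complex mat list" and Dopt :: "complex mat"
    and lam :: complex and x y z :: "complex vec"
  assumes "\<forall>k\<in>set r. 0 < k" and "\<forall>k\<in>set m. 0 < k"
    and "sum_list r + sum_list m = n"
    and "M \<in> carrier_mat n n" and "\<epsilon> > 0"
    and "pert_coords r m \<delta> \<Delta>" and "Dopt = pert_mat r \<delta> \<Delta>"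
    and "spectral_norm Dopt = 1"
    and "local_extremizer r m \<epsilon> M Dopt"
    and "simple_eigenvalue (complex_of_real \<epsilon> \<cdot>\<^sub>m (M * Dopt)) lam"
    and "largest_eigenvalue (complex_of_real \<epsilon> \<cdot>\<^sub>m (M * Dopt)) lam"
    and "lam = complex_of_real (cmod lam) * exp (\<i> * complex_of_real \<theta>)"
    and "eigenvector (complex_of_real \<epsilon> \<cdot>\<^sub>m (M * Dopt)) x lam"
    and "left_eigenvector (complex_of_real \<epsilon> \<cdot>\<^sub>m (M * Dopt)) y lam"
    and "complex_of_real s = exp (\<i> * complex_of_real \<theta>) * (x \<bullet>c y)" and "s > 0"
    and "z = mat_adjoint M *\<^sub>v y"
    and "\<forall>k<length r. vec_block (r @ m) k x \<bullet>c vec_block (r @ m) k z \<noteq> 0"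
    and "\<forall>h<length m. vec_norm2 (vec_block (r @ m) (length r + h) z)
                       * vec_norm2 (vec_block (r @ m) (length r + h) x) \<noteq> 0"
  shows "(\<forall>k<length r. cmod (\<delta> ! k) = 1) \<and> (\<forall>h<length m. spectral_norm (\<Delta> ! h) = 1)"
proof -
  note D = assms(6)
  have n: "n = sum_list (r @ m)" using assms(3) by simp
  have xy: "x \<bullet>c y \<noteq> 0" using assms(15,16) by auto
  have block_le: "spectral_norm (pert_blocks r \<delta> \<Delta> ! i) \<le> 1" if "i < length (r @ m)" for i
    using that length_pert_blocks[OF D] assms(7,8) nth_mem[of i "pert_blocks r \<delta> \<Delta>"]
      contraction_diag_block_mat_iff[of "pert_blocks r \<delta> \<Delta>"]
    by (simp add: spectral_norm_le_1_iff[symmetric] pert_mat_eq_diag_block_mat)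
  note stationary = extremizer_block_first_order_condition[OF assms(4) n assms(5)
      assms(9,10,11,13,14)[unfolded assms(7)] xy D, folded assms(17)]
  define zeros :: "complex mat list" where "zeros = map (\<lambda>k. 0\<^sub>m k k) m"
  have "cmod (\<delta> ! k) = 1" if k: "k < length r" for k
  proof (rule ccontr)
    assume ne: "cmod (\<delta> ! k) \<noteq> 1"
    have norm: "spectral_norm (pert_blocks r \<delta> \<Delta> ! k) = cmod (\<delta> ! k)"
      using assms(1) k by (simp add: nth_pert_blocks_scalar[OF D k] spectral_norm_smult_one)
    hence lt: "spectral_norm (pert_blocks r \<delta> \<Delta> ! k) < 1" using ne block_le[of k] k by simp
    define e :: "complex list" where "e = (replicate (length r) 0)[k := 1]"
    have E: "pert_coords r m e zeros" by (simp add: pert_coords_def e_def zeros_def)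
    have "pert_blocks r e zeros ! j = 0\<^sub>m ((r @ m) ! j) ((r @ m) ! j)"
      if "j < length (r @ m)" "j \<noteq> k" for j
      using that(1)
    proof (cases rule: pert_index_cases)
      case (scalar k')
      thus ?thesis using that k
        by (simp add: nth_pert_blocks_scalar[OF E] nth_append)
          (auto simp: e_def intro!: eq_matI)
    next
      case (full h)
      thus ?thesis by (simp add: nth_pert_blocks_full[OF E] nth_append) (simp add: zeros_def)
    qed
    hence "(pert_blocks r e zeros ! k *\<^sub>v vec_block (r @ m) k x) \<bullet>c vec_block (r @ m) k z = 0"
      by (intro stationary[OF E _ lt]) (use k in auto)
    moreover have "pert_blocks r e zeros ! k = 1\<^sub>m (r ! k)"
      using k by (simp add: nth_pert_blocks_scalar[OF E]) (auto simp: e_def intro!: eq_matI)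
    moreover have "1\<^sub>m (r ! k) *\<^sub>v vec_block (r @ m) k x = vec_block (r @ m) k x"
      using vec_block_carrier[of "r @ m" k x] k by (simp add: nth_append)
    ultimately show False using assms(18) k by simp
  qed
  moreover have "spectral_norm (\<Delta> ! h) = 1" if h: "h < length m" for h
  proof (rule ccontr)
    assume "spectral_norm (\<Delta> ! h) \<noteq> 1"
    hence lt: "spectral_norm (pert_blocks r \<delta> \<Delta> ! (length r + h)) < 1"
      using block_le[of "length r + h"] h by (simp add: nth_pert_blocks_full[OF D])
    define u v where "u = vec_block (r @ m) (length r + h) z"
      and "v = vec_block (r @ m) (length r + h) x"
    have uv: "u \<in> carrier_vec (m ! h)" "v \<in> carrier_vec (m ! h)"
      using vec_block_carrier[of "r @ m" "length r + h"] by (auto simp: u_def v_def nth_append)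
    \<comment> \<open>The direction \<open>z\<^sub>h x\<^sub>h\<^sup>*\<close>, supported in the \<open>h\<close>-th full block.\<close>
    define W where "W = mat (m ! h) (m ! h) (\<lambda>(i,j). u $ i * cnj (v $ j))"
    define e :: "complex list" where "e = replicate (length r) 0"
    define Es where "Es = zeros[h := W]"
    have E: "pert_coords r m e Es"
      using h by (auto simp: pert_coords_def e_def Es_def zeros_def nth_list_update W_def)
    have "pert_blocks r e Es ! j = 0\<^sub>m ((r @ m) ! j) ((r @ m) ! j)"
      if "j < length (r @ m)" "j \<noteq> length r + h" for j
      using that(1)
    proof (cases rule: pert_index_cases)
      case (scalar k)
      thus ?thesis
        by (simp add: nth_pert_blocks_scalar[OF E] nth_append)
          (auto simp: e_def intro!: eq_matI)
    next
      case (full h')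
      thus ?thesis using that
        by (simp add: nth_pert_blocks_full[OF E] nth_append) (simp add: zeros_def Es_def)
    qed
    hence "(pert_blocks r e Es ! (length r + h) *\<^sub>v v) \<bullet>c u = 0"
      unfolding u_def v_def by (intro stationary[OF E _ lt]) (use h in auto)
    moreover have "pert_blocks r e Es ! (length r + h) = W"
      using h by (simp add: nth_pert_blocks_full[OF E]) (simp add: Es_def zeros_def)
    ultimately have "vec_norm2 u * vec_norm2 v = 0"
      using outer_product_cscalar_prod[OF uv] by (simp add: W_def)
    thus False using assms(19) h by (simp add: u_def v_def)
  qed
  ultimately show ?thesis by blast
qed

end
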